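(* Let $W$ and $R$ be positive integers and let $\epsilon>0$ satisfy $\epsilon^{-1}\le 2W\left(1-\frac{1}{\log W}\right)$. Set $\upsilon=\lceil\log(\epsilon^{-1}\log W)\rceil$ and $k=\left\lceil\frac{1}{2\epsilon-2^{-\upsilon}}\right\rceil$, and assume $\frac Wk$ is an integer. Then Algorithm 2 (described in the context, run with these parameters) requires $$\left(2\log W+\frac{1}{2\epsilon}\right)(1+o(1))$$ bits of memory.
   Context: All logarithms are base 2, and $o(1)$ is for $W\to\infty$. The memory of the algorithm is the number of bits used to store its variables. For $z\in[0,1]$, $\mathrm{Round}_{\upsilon}(z)$ denotes rounding of $z$ to the nearest value $\widetilde z$ such that $2^{\upsilon}\widetilde z$ is an integer. Algorithm 2 (processing a stream of integers in $\{0,1,\dots,R\}$, one call of Add per element). Variables: a fixed-point number $y$, integers $B,i,m$ and a bit array $b=(b_0,\dots,b_{k-1})$, all initialized to $0$. Add(element $x$): first set $x'=\mathrm{Round}_{\upsilon}\left(\frac xR\right)$. If $m=\frac Wk-1$, then do in order: (1) $B\leftarrow B-b_i$; (2) if $y+x'\ge\frac Wk$, set $b_i\leftarrow1$ and $y\leftarrow y-\frac Wk+x'$; otherwise set $b_i\leftarrow0$ and $y\leftarrow y+x'$; (3) $B\leftarrow B+b_i$; (4) $m\leftarrow0$; (5) $i\leftarrow i+1\bmod k$. Otherwise (if $m\ne\frac Wk-1$): $y\leftarrow y+x'$ and $m\leftarrow m+1$. Query: return $R\cdot\left(\frac Wk\cdot B+y-\frac W{2k}-m\cdot b_i\right)$.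 The variable $y$ is stored with $\lceil\log(2\frac Wk)\rceil$ bits for its integral part and $\upsilon$ bits for its fractional part; $m,i,B$ are stored as binary integers with enough bits for their ranges; $b$ is stored as $k$ bits. *)

theory Defs
  imports Complex_Main
begin

text \<open>
  Fixed-point rounding to the nearest multiple of \<open>2\<^sup>-\<^sup>\<upsilon>\<close>; ties are rounded upwards.
  The precision is an integer because \<open>\<lceil>log (\<epsilon>\<^sup>-\<^sup>1 log W)\<rceil>\<close> is negative for very large \<open>\<epsilon>\<close>.
\<close>

definition fixed_round :: "int \<Rightarrow> real \<Rightarrow> real" where
  "fixed_round \<upsilon> z = of_int (round (2 powi \<upsilon> * z)) / 2 powi \<upsilon>"

record state =
  st_y :: real
  st_B :: int
  st_i :: nat
  st_m :: nat
  st_b :: "bool list"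

definition init_state :: "nat \<Rightarrow> state" where
  "init_state k = \<lparr>st_y = 0, st_B = 0, st_i = 0, st_m = 0, st_b = replicate k False\<rparr>"

definition add_element :: "nat \<Rightarrow> nat \<Rightarrow> nat \<Rightarrow> int \<Rightarrow> nat \<Rightarrow> state \<Rightarrow> state" where
  "add_element W R k \<upsilon> x s =
    (let L = real W / real k;
         x' = fixed_round \<upsilon> (real x / real R)
     in if real (st_m s) = L - 1 then
          let B' = st_B s - of_bool (st_b s ! st_i s);
              bit = (st_y s + x' \<ge> L);
              y' = (if bit then st_y s - L + x' else st_y s + x')
          in \<lparr>st_y = y',
              st_B = B' + of_bool bit,
              st_i = (st_i s + 1) mod k,
              st_m = 0,
              st_b = (st_b s)[st_i s := bit]\<rparr>
        else s\<lparr>st_y := st_y s + x', st_m := st_m s + 1\<rparr>)"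

definition query :: "nat \<Rightarrow> nat \<Rightarrow> nat \<Rightarrow> state \<Rightarrow> real" where
  "query W R k s =
    real R * (real W / real k * of_int (st_B s) + st_y s - real W / (2 * real k)
              - real (st_m s) * of_bool (st_b s ! st_i s))"

definition reachable_states :: "nat \<Rightarrow> nat \<Rightarrow> nat \<Rightarrow> int \<Rightarrow> state set" where
  "reachable_states W R k \<upsilon> =
    {fold (add_element W R k \<upsilon>) xs (init_state k) | xs. set xs \<subseteq> {0..R}}"

text \<open>The number of binary digits needed for an integer variable with range \<open>V\<close>.\<close>

definition bit_width :: "int set \<Rightarrow> nat" where
  "bit_width V = (LEAST n. V \<subseteq> {0..<2 ^ n})"

text \<open>
  The summands are the widths of \<open>y\<close> (integral and fractional part), \<open>m\<close>, \<open>i\<close>, \<open>B\<close> and \<open>b\<close>.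
  The range of an integer variable is the set of values it takes over all input streams; the
  value of \<open>B\<close> in the middle of an update lies between \<open>0\<close> and its previous value, so
  considering the states between updates suffices. A negative precision means that no
  fractional bits are stored.
\<close>

definition memory_bits :: "nat \<Rightarrow> nat \<Rightarrow> nat \<Rightarrow> int \<Rightarrow> nat" where
  "memory_bits W R k \<upsilon> =
    (let S = reachable_states W R k \<upsilon>
     in nat \<lceil>log 2 (2 * (real W / real k))\<rceil> + nat \<upsilon>
        + bit_width ((\<lambda>s. int (st_m s)) ` S)
        + bit_width ((\<lambda>s. int (st_i s)) ` S)
        + bit_width (st_B ` S)
        + k)"

definition precision :: "nat \<Rightarrow> real \<Rightarrow> int" where
  "precision W \<epsilon> = \<lceil>log 2 (inverse \<epsilon> * log 2 (real W))\<rceil>"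

definition num_blocks :: "nat \<Rightarrow> real \<Rightarrow> nat" where
  "num_blocks W \<epsilon> = nat \<lceil>1 / (2 * \<epsilon> - 2 powi (- precision W \<epsilon>))\<rceil>"

definition admissible :: "nat \<Rightarrow> nat \<Rightarrow> real \<Rightarrow> bool" where
  "admissible W R \<epsilon> \<longleftrightarrow>
     W > 0 \<and> R > 0 \<and> \<epsilon> > 0 \<and>
     inverse \<epsilon> \<le> 2 * real W * (1 - 1 / log 2 (real W)) \<and>
     real W / real (num_blocks W \<epsilon>) \<in> \<int>"

end

theory Submission
  imports Defs "HOL-Real_Asymp.Real_Asymp"
begin

text \<open>
  Write \<open>l = log W\<close>, \<open>L = W/k\<close> and \<open>T = 2 l + 1/(2\<epsilon>)\<close>. By the choice of \<open>\<upsilon>\<close>, \<open>2 powi -\<upsilon>\<close> is at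
  most \<open>\<epsilon>/l\<close>, so \<open>k\<close> exceeds \<open>1/(2\<epsilon>)\<close> by at most \<open>1/(2\<epsilon>l) + 1\<close>, while the number \<open>max \<upsilon> 0\<close>
  of fractional bits is \<open>log k\<close> up to \<open>log l + O(1)\<close>. Hence \<open>y\<close> takes about \<open>log L + log k = l\<close> bits,
  and so do \<open>m\<close> and \<open>i\<close> together; everything else, including the at most \<open>log (k + 1) + 1\<close> bits of
  \<open>B\<close>, is \<open>1/(2\<epsilon>) + O(log T + T/l)\<close>.
\<close>

section \<open>Widths of integer variables\<close>

text \<open>The least width is at most \<open>\<lceil>log 2 N\<rceil>\<close>, which suffices for
  \<open>{0..<int N}\<close>; rounding up costs the extra 1.\<close>

lemma bit_width_le_log:
  assumes "V \<subseteq> {0..<int N}" "N > 0"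
  shows "real (bit_width V) \<le> log 2 (real N) + 1"
proof -
  define n where "n = nat \<lceil>log 2 (real N)\<rceil>"
  have l0: "log 2 (real N) \<ge> 0" using assms(2) by simp
  have nn: "log 2 (real N) \<le> real n" unfolding n_def by linarith
  have "real N \<le> 2 powr real n"
    using nn assms(2) by (simp add: log_le_iff)
  hence "real N \<le> real (2 ^ n)" by (simp add: powr_realpow)
  hence "N \<le> 2 ^ n" by (simp only: of_nat_le_iff)
  hence "int N \<le> 2 ^ n" by (metis of_nat_le_iff of_nat_numeral of_nat_power)
  hence "{0..<int N} \<subseteq> {0..<2 ^ n}" by simp
  with assms(1) have "V \<subseteq> {0..<2 ^ n}" by (rule order_trans)
  hence "bit_width V \<le> n" unfolding bit_width_def by (rule Least_le)
  moreover have "real n \<le> log 2 (real N) + 1" using l0 unfolding n_def by linarith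
  ultimately show ?thesis by linarith
qed

text \<open>The bound by \<open>M\<close> only guarantees that some width fits, so that the
  \<open>LEAST\<close> in \<open>bit_width\<close> is attained; \<open>M < 2 ^ M\<close> makes
  \<open>M\<close> itself such a width. The attained value \<open>int N - 1\<close> then forces the
  estimate.\<close>

lemma log_le_bit_width:
  assumes "V \<subseteq> {0..<int M}" "int N - 1 \<in> V" "N > 0"
  shows "log 2 (real N) \<le> real (bit_width V)"
proof -
  have "int M < 2 ^ M" by (metis of_nat_less_two_power)
  hence "{0..<int M} \<subseteq> {0..<2 ^ M}" by simp
  with assms(1) have "V \<subseteq> {0..<2 ^ M}" by (rule order_trans)
  hence "V \<subseteq> {0..<2 ^ bit_width V}" unfolding bit_width_def by (rule LeastI)
  hence "int N - 1 < 2 ^ bit_width V" using assms(2) by force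
  hence "int N \<le> int (2 ^ bit_width V)" unfolding of_nat_power of_nat_numeral by linarith
  hence "N \<le> 2 ^ bit_width V" by (simp only: of_nat_le_iff)
  hence "real N \<le> real (2 ^ bit_width V)" by (simp only: of_nat_le_iff)
  hence "real N \<le> 2 powr real (bit_width V)" by (simp add: powr_realpow)
  thus ?thesis using assms(3) by (simp add: log_le_iff)
qed

section \<open>Reachable states\<close>

text \<open>Matches the subtract-then-add update of \<open>B\<close>, which thereby remains the
  number of ones in \<open>b\<close>.\<close>

lemma sum_of_bool_list_update:
  assumes "i < length b"
  shows "(\<Sum>j<length b. of_bool (b[i := c] ! j))
           = (\<Sum>j<length b. of_bool (b ! j)) - of_bool (b ! i) + (of_bool c :: int)"
proof -
  have "(\<Sum>j<length b. of_bool (b[i := c] ! j))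
          = (of_bool c :: int) + (\<Sum>j\<in>{..<length b} - {i}. of_bool (b ! j))"
    using assms by (subst sum.remove[of _ i]) (auto intro!: sum.cong)
  moreover have "(\<Sum>j<length b. of_bool (b ! j))
          = (of_bool (b ! i) :: int) + (\<Sum>j\<in>{..<length b} - {i}. of_bool (b ! j))"
    using assms by (subst sum.remove[of _ i]) auto
  ultimately show ?thesis by simp
qed

text \<open>Each call advances a two-digit counter: \<open>m\<close> is the digit modulo
  \<open>L\<close>, and its carry moves \<open>i\<close> cyclically. Neither the rounding nor the
  value of \<open>y\<close> affects the two digits, so the induction leaves the new bit
  arbitrary.\<close>

lemma fold_add_element:
  fixes W R k L :: nat and \<upsilon> :: int
  assumes "W = L * k" "L > 0" "k > 0"
  defines "s \<equiv> \<lambda>xs. fold (add_element W R k \<upsilon>) xs (init_state k)"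
  shows "st_m (s xs) = length xs mod L \<and> st_i (s xs) = length xs div L mod k \<and>
         length (st_b (s xs)) = k \<and> st_B (s xs) = (\<Sum>j<k. of_bool (st_b (s xs) ! j))"
proof (induction xs rule: rev_induct)
  case Nil
  show ?case by (simp add: s_def init_state_def)
next
  case (snoc x xs)
  define n where "n = length xs"
  define c where "c \<longleftrightarrow> st_y (s xs) + fixed_round \<upsilon> (real x / real R) \<ge> real L"
  have L: "real W / real k = real L" using assms by simp
  have step: "s (xs @ [x]) = add_element W R k \<upsilon> x (s xs)" by (simp add: s_def)
  have m_iff: "real (st_m (s xs)) = real L - 1 \<longleftrightarrow> Suc (n mod L) = L"
    using snoc.IH assms(2) unfolding n_def by (auto simp: of_nat_diff)
  show ?case
  proof (cases "Suc (n mod L) = L")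
    case True
    have i: "st_i (s xs) < length (st_b (s xs))" using snoc.IH assms(3) by simp
    have "Suc n mod L = 0" "Suc n div L = Suc (n div L)"
      using True by (auto simp: mod_Suc div_Suc)
    moreover have "Suc (n div L mod k) mod k = Suc (n div L) mod k"
      by (simp add: mod_Suc_eq)
    ultimately show ?thesis
      using snoc.IH True m_iff sum_of_bool_list_update[OF i, of c]
      unfolding step add_element_def Let_def L
      by (simp add: n_def c_def)
  next
    case False
    have "Suc n mod L = Suc (n mod L)" "Suc n div L = n div L"
      using False by (auto simp: mod_Suc div_Suc)
    thus ?thesis
      using snoc.IH False m_iff unfolding step add_element_def Let_def L
      by (simp add: n_def)
  qed
qed

text \<open>The inclusions follow from the invariants. For attainment a stream of zeros suffices:
  length \<open>L - 1\<close> gives the largest \<open>m\<close> and length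
  \<open>L * (k - 1)\<close> the largest \<open>i\<close>. For \<open>B\<close> an upper range is
  enough, since its width only enters the error term.\<close>

lemma reachable_ranges:
  fixes W R k L :: nat and \<upsilon> :: int
  assumes "W = L * k" "L > 0" "k > 0"
  defines "S \<equiv> reachable_states W R k \<upsilon>"
  shows "(\<lambda>s. int (st_m s)) ` S \<subseteq> {0..<int L}" "int L - 1 \<in> (\<lambda>s. int (st_m s)) ` S"
    and "(\<lambda>s. int (st_i s)) ` S \<subseteq> {0..<int k}" "int k - 1 \<in> (\<lambda>s. int (st_i s)) ` S"
    and "st_B ` S \<subseteq> {0..<int (k + 1)}"
proof -
  note inv = fold_add_element[OF assms(1-3), of R \<upsilon>]
  have attained: "\<exists>s\<in>S. st_m s = n mod L \<and> st_i s = n div L mod k" for n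
  proof -
    have "set (replicate n 0) \<subseteq> {0..R}" by auto
    hence "fold (add_element W R k \<upsilon>) (replicate n 0) (init_state k) \<in> S"
      unfolding S_def reachable_states_def by blast
    thus ?thesis using inv[of "replicate n 0"] unfolding length_replicate by blast
  qed
  show "(\<lambda>s. int (st_m s)) ` S \<subseteq> {0..<int L}"
    using inv assms(2) by (auto simp: S_def reachable_states_def)
  show "(\<lambda>s. int (st_i s)) ` S \<subseteq> {0..<int k}"
    using inv assms(3) by (auto simp: S_def reachable_states_def)
  show "int L - 1 \<in> (\<lambda>s. int (st_m s)) ` S"
    using attained[of "L - 1"] assms(2) by (force simp: of_nat_diff)
  show "int k - 1 \<in> (\<lambda>s. int (st_i s)) ` S"
    using attained[of "L * (k - 1)"] assms(2,3) by (force simp: of_nat_diff)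
  show "st_B ` S \<subseteq> {0..<int (k + 1)}"
  proof
    fix B assume "B \<in> st_B ` S"
    then obtain xs where
      B: "B = st_B (fold (add_element W R k \<upsilon>) xs (init_state k))"
      by (auto simp: S_def reachable_states_def)
    define b where "b = st_b (fold (add_element W R k \<upsilon>) xs (init_state k))"
    have "B = (\<Sum>j<k. of_bool (b ! j))" using inv B unfolding b_def by blast
    moreover have "(\<Sum>j<k. of_bool (b ! j) :: int) \<le> (\<Sum>j<k. 1)"
      by (rule sum_mono) simp
    moreover have "(\<Sum>j<k. of_bool (b ! j) :: int) \<ge> 0" by (rule sum_nonneg) simp
    ultimately show "B \<in> {0..<int (k + 1)}" by simp
  qed
qed

text \<open>One \<open>log 2 L\<close> comes from \<open>y\<close> and one from \<open>m\<close>.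
  The lower bound estimates the width of \<open>B\<close> by 0. In the upper bound, 5 collects 2 for
  \<open>y\<close> (the doubling and the ceiling) and 1 each for \<open>m\<close>, \<open>i\<close>
  and \<open>B\<close>.\<close>

lemma memory_bits_bounds:
  fixes W R k L :: nat and \<upsilon> :: int
  assumes "W = L * k" "L > 0" "k > 0"
  shows "real (memory_bits W R k \<upsilon>) \<ge> 2 * log 2 L + 1 + nat \<upsilon> + log 2 k + k"
    and "real (memory_bits W R k \<upsilon>)
           \<le> 2 * log 2 L + 5 + nat \<upsilon> + log 2 k + log 2 (real k + 1) + k"
proof -
  note r = reachable_ranges[OF assms, of R \<upsilon>]
  note up = bit_width_le_log[OF r(1) assms(2)] bit_width_le_log[OF r(3) assms(3)]
    bit_width_le_log[OF r(5)]
  note low = log_le_bit_width[OF r(1,2) assms(2)] log_le_bit_width[OF r(3,4) assms(3)]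
  have y: "real W / real k = real L" using assms by simp
  have "log 2 (2 * real L) = 1 + log 2 L" using assms(2) by (simp add: log_mult)
  moreover have "log 2 (real L) \<ge> 0" using assms(2) by simp
  ultimately have "real (nat \<lceil>log 2 (2 * real L)\<rceil>) \<ge> 1 + log 2 L"
    "real (nat \<lceil>log 2 (2 * real L)\<rceil>) \<le> 2 + log 2 L"
    by linarith+
  thus "real (memory_bits W R k \<upsilon>) \<ge> 2 * log 2 L + 1 + nat \<upsilon> + log 2 k + k"
    and "real (memory_bits W R k \<upsilon>)
           \<le> 2 * log 2 L + 5 + nat \<upsilon> + log 2 k + log 2 (real k + 1) + k"
    using up low unfolding memory_bits_def Let_def y by (simp_all add: add.commute)
qed

section \<open>The parameters\<close>

lemma precision_bounds:
  assumes "\<epsilon> > 0" "log 2 (real W) > 0"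
  shows "2 powi (- precision W \<epsilon>) \<le> \<epsilon> / log 2 W"
    and "2 powi (- precision W \<epsilon>) > (0 :: real)"
    and "log 2 (inverse \<epsilon>) + log 2 (log 2 W) \<le> precision W \<epsilon>"
    and "precision W \<epsilon> \<le> log 2 (inverse \<epsilon>) + log 2 (log 2 W) + 1"
proof -
  define x where "x = inverse \<epsilon> * log 2 (real W)"
  have x: "x > 0" using assms by (simp add: x_def)
  have v: "real_of_int (precision W \<epsilon>) \<ge> log 2 x" "real_of_int (precision W \<epsilon>) \<le> log 2 x + 1"
    unfolding precision_def x_def by linarith+
  have "log 2 x = log 2 (inverse \<epsilon>) + log 2 (log 2 W)"
    unfolding x_def using assms by (intro log_mult_pos) auto
  with v show "log 2 (inverse \<epsilon>) + log 2 (log 2 W) \<le> precision W \<epsilon>"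
    "precision W \<epsilon> \<le> log 2 (inverse \<epsilon>) + log 2 (log 2 W) + 1" by auto
  have "x \<le> 2 powr (precision W \<epsilon>)" using v(1) x by (simp add: log_le_iff)
  hence "x \<le> 2 powi precision W \<epsilon>" by (simp add: powr_real_of_int')
  hence "inverse (2 powi precision W \<epsilon>) \<le> inverse x" using x by (simp add: le_imp_inverse_le)
  thus "2 powi (- precision W \<epsilon>) \<le> \<epsilon> / log 2 W"
    by (simp add: power_int_minus x_def divide_inverse)
  show "2 powi (- precision W \<epsilon>) > (0 :: real)" by simp
qed

lemma num_blocks_bounds:
  assumes "\<epsilon> > 0" "log 2 (real W) \<ge> 1"
  shows "real (num_blocks W \<epsilon>) \<ge> 1 / (2 * \<epsilon>)"
    and "real (num_blocks W \<epsilon>) \<le> 1 / (2 * \<epsilon>) * (1 + 1 / log 2 W) + 1"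
proof -
  define l where "l = log 2 (real W)"
  define d where "d = 2 * \<epsilon> - 2 powi (- precision W \<epsilon>)"
  have l: "l \<ge> 1" using assms by (simp add: l_def)
  have q: "\<epsilon> / l \<le> \<epsilon>" using l assms(1) by (simp add: divide_le_eq)
  have d: "d \<ge> 2 * \<epsilon> - \<epsilon> / l" "d < 2 * \<epsilon>"
    using precision_bounds(1,2)[of \<epsilon> W] assms unfolding d_def l_def by auto
  have d0: "d > 0" using d q assms(1) by linarith
  have low: "1 / d \<ge> 1 / (2 * \<epsilon>)" using d d0 by (simp add: frac_le)
  \<comment> \<open>The product equals
    \<open>(1 - 1/(2l)) (1 + 1/l) = 1 + 1/(2l) - 1/(2l^2)\<close>, which is at least 1 because
    \<open>l \<ge> 1\<close>.\<close>
  have "1 \<le> (2 * \<epsilon> - \<epsilon> / l) * (1 / (2 * \<epsilon>) * (1 + 1 / l))"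
    using l assms(1) by (simp add: field_simps)
  also have "\<dots> \<le> d * (1 / (2 * \<epsilon>) * (1 + 1 / l))"
    using d l assms(1) by (intro mult_right_mono) auto
  finally have up: "1 / d \<le> 1 / (2 * \<epsilon>) * (1 + 1 / l)"
    using d0 by (simp add: divide_le_eq mult.commute)
  have n: "num_blocks W \<epsilon> = nat \<lceil>1 / d\<rceil>" by (simp add: num_blocks_def d_def)
  have "0 \<le> 1 / d" using d0 by simp
  hence "real (num_blocks W \<epsilon>) \<ge> 1 / d" "real (num_blocks W \<epsilon>) \<le> 1 / d + 1"
    unfolding n by linarith+
  with low up show "real (num_blocks W \<epsilon>) \<ge> 1 / (2 * \<epsilon>)"
    "real (num_blocks W \<epsilon>) \<le> 1 / (2 * \<epsilon>) * (1 + 1 / log 2 W) + 1"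
    unfolding l_def by linarith+
qed

lemma admissible_block_length:
  assumes "admissible W R \<epsilon>" "log 2 (real W) \<ge> 1"
  obtains L where "W = L * num_blocks W \<epsilon>" "L > 0" "num_blocks W \<epsilon> > 0"
proof -
  have e: "\<epsilon> > 0" and W: "W > 0" and Z: "real W / real (num_blocks W \<epsilon>) \<in> \<int>"
    using assms(1) by (auto simp: admissible_def)
  \<comment> \<open>Integrality of \<open>W / k\<close> does not exclude \<open>k = 0\<close>, as
    division by zero yields 0; the lower bound on \<open>k\<close> does.\<close>
  have "0 < 1 / (2 * \<epsilon>)" using e by simp
  hence k: "num_blocks W \<epsilon> > 0"
    using num_blocks_bounds(1)[OF e assms(2)] by (cases "num_blocks W \<epsilon>") auto
  from Z obtain z where z: "real W / real (num_blocks W \<epsilon>) = of_int z" by (auto elim: Ints_cases)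
  have "0 < real W / real (num_blocks W \<epsilon>)" using W k by simp
  with z have z0: "z > 0" by simp
  have "real W = of_int z * real (num_blocks W \<epsilon>)" using z k by (simp add: field_simps)
  hence "real W = real (nat z * num_blocks W \<epsilon>)" using z0 by simp
  hence "W = nat z * num_blocks W \<epsilon>" by (simp only: of_nat_eq_iff)
  thus thesis using that z0 k by simp
qed

section \<open>The relative error\<close>

text \<open>Both \<open>log 2 l\<close> and \<open>log 2 (k + 1)\<close> are absorbed into
  \<open>log 2 T\<close>, so that the error depends on \<open>\<epsilon>\<close> through
  \<open>T\<close> alone and can be made small uniformly.\<close>

lemma memory_bits_error:
  assumes adm: "admissible W R \<epsilon>" and l1: "log 2 (real W) \<ge> 1"
  defines "T \<equiv> 2 * log 2 (real W) + 1 / (2 * \<epsilon>)"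
  defines "M \<equiv> real (memory_bits W R (num_blocks W \<epsilon>) (precision W \<epsilon>))"
  shows "T \<le> M" and "M \<le> T + 3 * log 2 T + 11 + T / log 2 W"
proof -
  define l where "l = log 2 (real W)"
  define k where "k = num_blocks W \<epsilon>"
  define v where "v = precision W \<epsilon>"
  define K where "K = 1 / (2 * \<epsilon>)"
  have e: "\<epsilon> > 0" using adm by (simp add: admissible_def)
  obtain L where L: "W = L * k" "L > 0" "k > 0"
    using admissible_block_length[OF adm l1] unfolding k_def by metis
  have K0: "K > 0" using e by (simp add: K_def)
  have l: "l \<ge> 1" using l1 by (simp add: l_def)
  have inv: "inverse \<epsilon> = 2 * K" by (simp add: K_def field_simps)
  have kb: "K \<le> k" "k \<le> K * (1 + 1 / l) + 1"
    using num_blocks_bounds[OF e l1] by (simp_all add: k_def K_def l_def)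
  have Kl: "K / l \<le> K" using K0 l by (simp add: divide_le_eq)
  have k2: "k \<le> 2 * K + 1" using kb(2) Kl by (simp add: distrib_left)
  have lWk: "l = log 2 L + log 2 k" unfolding l_def L(1) using L by (simp add: log_mult_pos)
  have ll: "log 2 l \<ge> 0" using l by simp
  have lk: "log 2 k \<ge> 0" using L(3) by simp
  have vb: "log 2 (2 * K) + log 2 l \<le> v" "v \<le> log 2 (2 * K) + log 2 l + 1"
    using precision_bounds(3,4)[OF e, of W] l unfolding v_def inv l_def by auto
  \<comment> \<open>If \<open>2 * K \<ge> 1\<close>, then \<open>k \<le> 4 * K\<close> and the bound
    on \<open>v\<close> applies. Otherwise \<open>v\<close> may be negative, but
    \<open>k \<le> 2\<close> makes the right-hand side at most 0.\<close>
  have v_low: "real (nat v) \<ge> log 2 k - 1"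
  proof (cases "2 * K \<ge> 1")
    case True
    have "log 2 k \<le> log 2 (2 * (2 * K))" using True k2 L(3) by simp
    also have "\<dots> = log 2 2 + log 2 (2 * K)" using K0 by (intro log_mult_pos) auto
    finally show ?thesis using vb(1) ll by simp
  next
    case False
    hence "log 2 k \<le> log 2 2" using k2 L(3) by (intro log_mono) auto
    thus ?thesis by simp
  qed
  have "log 2 (2 * K) \<le> log 2 (2 * k)" using kb(1) K0 by simp
  also have "\<dots> = 1 + log 2 k" using L(3) by (simp add: log_mult_pos)
  finally have v_up: "real (nat v) \<le> log 2 k + log 2 l + 2" using vb(2) ll lk by linarith
  have T: "T = 2 * l + K" by (simp add: T_def l_def K_def)
  have M: "M = real (memory_bits W R k v)" by (simp add: M_def k_def v_def)
  note mb = memory_bits_bounds[OF L, where R = R and \<upsilon> = v, folded M]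
  \<comment> \<open>The loss of 1 in \<open>v_low\<close> is exactly offset by the 1 for doubling
    the range of \<open>y\<close>, so no error term remains on this side.\<close>
  show "T \<le> M" using mb(1) v_low kb(1) lWk unfolding T by linarith
  have Tl: "l \<le> T" "real k + 1 \<le> 2 * T" using T l K0 k2 by linarith+
  have "log 2 l \<le> log 2 T" using Tl l by simp
  moreover have "log 2 (real k + 1) \<le> log 2 (2 * T)" using Tl by simp
  moreover have "log 2 (2 * T) = 1 + log 2 T" using Tl l by (simp add: log_mult_pos)
  moreover have "k \<le> K + T / l + 1"
  proof -
    have "K / l \<le> T / l" using T l by (intro divide_right_mono) auto
    thus ?thesis using kb(2) by (simp add: distrib_left)
  qed
  \<comment> \<open>The collected estimates amount to \<open>2 * log 2 T + 9\<close>; nonnegativity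
    allows the rounder \<open>3 * log 2 T + 11\<close>.\<close>
  moreover have "log 2 T \<ge> 0" using Tl l by simp
  ultimately show "M \<le> T + 3 * log 2 T + 11 + T / log 2 W"
    using mb(2) v_up lWk unfolding l_def[symmetric] T by linarith
qed

text \<open>The \<open>o(1)\<close> is read uniformly: the threshold for \<open>W\<close> is chosen
  before \<open>R\<close> and \<open>\<epsilon>\<close>. This works because
  \<open>T \<ge> log 2 W\<close> for every \<open>\<epsilon>\<close>, so a large \<open>W\<close>
  alone makes both \<open>(3 * log 2 T + 11) / T\<close> and \<open>1 / log 2 W\<close>
  small.\<close>

theorem theorem16:
  "\<exists>\<eta> :: nat \<Rightarrow> nat \<Rightarrow> real \<Rightarrow> real.
     (\<forall>W R \<epsilon>. admissible W R \<epsilon> \<longrightarrow>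
        real (memory_bits W R (num_blocks W \<epsilon>) (precision W \<epsilon>))
          = (2 * log 2 (real W) + 1 / (2 * \<epsilon>)) * (1 + \<eta> W R \<epsilon>)) \<and>
     (\<forall>\<delta>>0. \<forall>\<^sub>F W in sequentially. \<forall>R \<epsilon>. admissible W R \<epsilon> \<longrightarrow> \<bar>\<eta> W R \<epsilon>\<bar> < \<delta>)"
proof -
  define M where "M W R \<epsilon> = real (memory_bits W R (num_blocks W \<epsilon>) (precision W \<epsilon>))"
    for W R \<epsilon>
  define T where "T W \<epsilon> = 2 * log 2 (real W) + 1 / (2 * \<epsilon>)" for W :: nat and \<epsilon>
  define \<eta> where "\<eta> W R \<epsilon> = M W R \<epsilon> / T W \<epsilon> - 1" for W R \<epsilon>
  have "M W R \<epsilon> = T W \<epsilon> * (1 + \<eta> W R \<epsilon>)" if "admissible W R \<epsilon>" for W R \<epsilon>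
  proof -
    have "log 2 (real W) \<ge> 0" "1 / (2 * \<epsilon>) > 0"
      using that by (auto simp: admissible_def)
    hence "T W \<epsilon> > 0" unfolding T_def by linarith
    thus ?thesis by (simp add: \<eta>_def)
  qed
  moreover have "\<forall>\<^sub>F W in sequentially. \<forall>R \<epsilon>. admissible W R \<epsilon> \<longrightarrow> \<bar>\<eta> W R \<epsilon>\<bar> < \<delta>"
    if \<delta>: "\<delta> > 0" for \<delta>
  proof -
    have "((\<lambda>t. (3 * log 2 t + 11) / t) \<longlongrightarrow> (0 :: real)) at_top" by real_asymp
    hence "\<forall>\<^sub>F t in at_top. (3 * log 2 t + 11) / t < \<delta> / 2"
      by (rule order_tendstoD) (use \<delta> in simp)
    then obtain t0 where t0: "\<And>t. t \<ge> t0 \<Longrightarrow> (3 * log 2 t + 11) / t < \<delta> / 2"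
      by (auto simp: eventually_at_top_linorder)
    have "filterlim (\<lambda>W. log 2 (real W)) at_top sequentially" by real_asymp
    \<comment> \<open>The bound 1 meets the hypothesis of \<open>memory_bits_error\<close>,
      \<open>t0\<close> controls the logarithmic term, and \<open>2 / \<delta>\<close> leaves at
      most \<open>\<delta> / 2\<close> for \<open>1 / log 2 W\<close>.\<close>
    hence "\<forall>\<^sub>F W in sequentially. log 2 (real W) \<ge> max (max 1 t0) (2 / \<delta>)"
      unfolding filterlim_at_top by blast
    thus ?thesis
    proof eventually_elim
      case (elim W)
      show ?case
      proof (intro allI impI)
        fix R \<epsilon> assume adm: "admissible W R \<epsilon>"
        have l: "log 2 (real W) \<ge> 1" "log 2 (real W) \<ge> t0" "log 2 (real W) \<ge> 2 / \<delta>"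
          using elim by auto
        have "1 / (2 * \<epsilon>) > 0" using adm by (auto simp: admissible_def)
        hence T: "T W \<epsilon> \<ge> t0" "T W \<epsilon> > 0" using l unfolding T_def by linarith+
        note err = memory_bits_error[OF adm l(1), folded M_def T_def]
        have "\<eta> W R \<epsilon> \<ge> 0" using err(1) T(2) by (simp add: \<eta>_def)
        moreover have "M W R \<epsilon> / T W \<epsilon>
            \<le> (T W \<epsilon> + 3 * log 2 (T W \<epsilon>) + 11 + T W \<epsilon> / log 2 W) / T W \<epsilon>"
          using err(2) T(2) by (intro divide_right_mono) auto
        hence "\<eta> W R \<epsilon> \<le> (3 * log 2 (T W \<epsilon>) + 11) / T W \<epsilon> + 1 / log 2 W"
          using T(2) by (simp add: \<eta>_def add_divide_distrib)
        moreover have "1 / log 2 W \<le> \<delta> / 2"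
          using l(1,3) \<delta> by (simp add: field_simps)
        ultimately show "\<bar>\<eta> W R \<epsilon>\<bar> < \<delta>" using t0[OF T(1)] by linarith
      qed
    qed
  qed
  ultimately show ?thesis unfolding M_def T_def by (intro exI[of _ \<eta>]) blast
qed

end
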